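(* Let $(M,g)$ be a connected $n$-dimensional Riemannian manifold with $n>1$, let $f$ be a smooth function on $M$, let $\lambda,\mu$ be real constants, let $\xi:=\mathrm{grad}(f)$ and let $\eta=df$ be the $g$-dual $1$-form of $\xi$. Suppose that $\xi$ is of unit length and that $(g,\xi,\lambda,\mu)$ is a gradient quasi-Yamabe soliton on $M$, i.e. $$\mathrm{Hess}(f)+(\lambda-\mathrm{scal})\,g+\mu\, df\otimes df=0 .$$ If $\xi(\mathrm{scal})$ is constant along the integral curves of $\xi$ and $\mathrm{Hess}(\mathrm{scal})$ is degenerate in the direction of $\xi$, then $M$ is of constant scalar curvature.
   Context: $\mathrm{scal}$ is the scalar curvature of $(M,g)$, $\nabla$ is the Levi-Civita connection, and $\mathrm{Hess}(u)(X,Y)=g(\nabla_X\mathrm{grad}(u),Y)$ for a smooth function $u$. "$\mathrm{Hess}(\mathrm{scal})$ is degenerate in the direction of $\xi$" means $\mathrm{Hess}(\mathrm{scal})(\xi,\xi)=\xi(\xi(\mathrm{scal}))-(\nabla_\xi\xi)(\mathrm{scal})=0$. A quasi-Yamabe soliton (as opposed to an almost quasi-Yamabe soliton, where $\lambda,\mu$ may be functions) is one in which $\lambda$ and $\mu$ are constants. *)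

theory Defs
  imports "HOL-Analysis.Analysis"
begin

text \<open>A manifold is a topological space, here a whole type \<open>'a\<close>, together with a smooth atlas.
  Its dimension is \<open>CARD('n)\<close>, where the charts take values in \<open>real ^ 'n\<close>.\<close>

text \<open>The differentiability class \<open>C\<^sup>k\<close> on an open set \<open>S\<close>, by recursion on \<open>k\<close> through all
  directional derivatives.\<close>

primrec C_k_on ::
    "nat \<Rightarrow> ('e::real_normed_vector \<Rightarrow> 'b::real_normed_vector) \<Rightarrow> 'e set \<Rightarrow> bool" where
  "C_k_on 0 f S \<longleftrightarrow> continuous_on S f"
| "C_k_on (Suc k) f S \<longleftrightarrow>
     (\<forall>x\<in>S. f differentiable (at x)) \<and>
     (\<forall>v. C_k_on k (\<lambda>x. frechet_derivative f (at x) v) S)"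

definition smooth_on ::
    "'e::real_normed_vector set \<Rightarrow> ('e \<Rightarrow> 'b::real_normed_vector) \<Rightarrow> bool" where
  "smooth_on S f \<longleftrightarrow> (\<forall>k. C_k_on k f S)"


subsection \<open>Smooth manifolds, tangent vectors and vector fields\<close>

text \<open>A chart \<open>(U, \<phi>)\<close> only matters through the restriction of \<open>\<phi>\<close> to \<open>U\<close>.\<close>

type_synonym ('a, 'n) chart = "'a set \<times> ('a \<Rightarrow> real ^ 'n)"

definition is_chart :: "('a::topological_space, 'n::finite) chart \<Rightarrow> bool" where
  "is_chart c \<longleftrightarrow> (case c of (U, \<phi>) \<Rightarrow>
     open U \<and> open (\<phi> ` U) \<and> inj_on \<phi> U \<and> homeomorphism U (\<phi> ` U) \<phi> (inv_into U \<phi>))"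

definition smooth_atlas :: "('a::topological_space, 'n::finite) chart set \<Rightarrow> bool" where
  "smooth_atlas A \<longleftrightarrow>
     (\<forall>c\<in>A. is_chart c) \<and>
     (\<Union>(U, \<phi>)\<in>A. U) = UNIV \<and>
     (\<forall>(U, \<phi>)\<in>A. \<forall>(V, \<psi>)\<in>A. smooth_on (\<phi> ` (U \<inter> V)) (\<psi> \<circ> inv_into U \<phi>))"

definition smooth_fun :: "('a, 'n::finite) chart set \<Rightarrow> ('a \<Rightarrow> real) \<Rightarrow> bool" where
  "smooth_fun A u \<longleftrightarrow> (\<forall>(U, \<phi>)\<in>A. smooth_on (\<phi> ` U) (u \<circ> inv_into U \<phi>))"

text \<open>Tangent vectors at \<open>p\<close> are the derivations at \<open>p\<close> of the algebra of smooth functions. They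
  are set to \<open>0\<close> on non-smooth functions, so that equality of derivations is equality of HOL
  functions.\<close>

type_synonym 'a tangent = "('a \<Rightarrow> real) \<Rightarrow> real"

definition tangent_space :: "('a, 'n::finite) chart set \<Rightarrow> 'a \<Rightarrow> 'a tangent set" where
  "tangent_space A p = {v.
     (\<forall>u w. smooth_fun A u \<longrightarrow> smooth_fun A w \<longrightarrow> v (\<lambda>x. u x + w x) = v u + v w) \<and>
     (\<forall>c u. smooth_fun A u \<longrightarrow> v (\<lambda>x. c * u x) = c * v u) \<and>
     (\<forall>u w. smooth_fun A u \<longrightarrow> smooth_fun A w \<longrightarrow> v (\<lambda>x. u x * w x) = u p * v w + w p * v u) \<and>
     (\<forall>u. \<not> smooth_fun A u \<longrightarrow> v u = 0)}"

type_synonym 'a vfield = "'a \<Rightarrow> 'a tangent"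

text \<open>\<open>lie_der X u\<close> is the function \<open>X(u) = du(X)\<close>.\<close>

definition lie_der :: "'a vfield \<Rightarrow> ('a \<Rightarrow> real) \<Rightarrow> 'a \<Rightarrow> real" where
  "lie_der X u = (\<lambda>p. X p u)"

definition smooth_vfield :: "('a, 'n::finite) chart set \<Rightarrow> 'a vfield \<Rightarrow> bool" where
  "smooth_vfield A X \<longleftrightarrow>
     (\<forall>p. X p \<in> tangent_space A p) \<and> (\<forall>u. smooth_fun A u \<longrightarrow> smooth_fun A (lie_der X u))"

definition vf_add :: "'a vfield \<Rightarrow> 'a vfield \<Rightarrow> 'a vfield" where
  "vf_add X Y = (\<lambda>p u. X p u + Y p u)"

definition vf_diff :: "'a vfield \<Rightarrow> 'a vfield \<Rightarrow> 'a vfield" where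
  "vf_diff X Y = (\<lambda>p u. X p u - Y p u)"

definition vf_scale :: "('a \<Rightarrow> real) \<Rightarrow> 'a vfield \<Rightarrow> 'a vfield" where
  "vf_scale h X = (\<lambda>p u. h p * X p u)"

definition lie_bracket :: "'a vfield \<Rightarrow> 'a vfield \<Rightarrow> 'a vfield" where
  "lie_bracket X Y = (\<lambda>p u. X p (lie_der Y u) - Y p (lie_der X u))"

text \<open>Curves with velocity \<open>X\<close> defined on an open interval \<open>I\<close>; velocities are tested on smooth
  functions.\<close>

definition integral_curve ::
    "('a::topological_space, 'n::finite) chart set \<Rightarrow> 'a vfield \<Rightarrow> real set \<Rightarrow> (real \<Rightarrow> 'a) \<Rightarrow> bool"
  where
  "integral_curve A X I \<gamma> \<longleftrightarrow>
     open I \<and> is_interval I \<and> continuous_on I \<gamma> \<and>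
     (\<forall>u t. smooth_fun A u \<longrightarrow> t \<in> I \<longrightarrow> ((u \<circ> \<gamma>) has_real_derivative X (\<gamma> t) u) (at t))"


subsection \<open>Riemannian metrics, the Levi-Civita connection and curvature\<close>

type_synonym 'a metric = "'a \<Rightarrow> 'a tangent \<Rightarrow> 'a tangent \<Rightarrow> real"

definition metric_app :: "'a metric \<Rightarrow> 'a vfield \<Rightarrow> 'a vfield \<Rightarrow> 'a \<Rightarrow> real" where
  "metric_app g X Y = (\<lambda>p. g p (X p) (Y p))"

definition riemannian_metric :: "('a, 'n::finite) chart set \<Rightarrow> 'a metric \<Rightarrow> bool" where
  "riemannian_metric A g \<longleftrightarrow>
     (\<forall>p. \<forall>v\<in>tangent_space A p. \<forall>w\<in>tangent_space A p.
        g p v w = g p w v \<and>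
        (\<forall>z\<in>tangent_space A p. g p (\<lambda>u. v u + w u) z = g p v z + g p w z) \<and>
        (\<forall>c. g p (\<lambda>u. c * v u) w = c * g p v w) \<and>
        (v \<noteq> (\<lambda>u. 0) \<longrightarrow> g p v v > 0)) \<and>
     (\<forall>X Y. smooth_vfield A X \<longrightarrow> smooth_vfield A Y \<longrightarrow> smooth_fun A (metric_app g X Y))"

type_synonym 'a connection = "'a vfield \<Rightarrow> 'a vfield \<Rightarrow> 'a vfield"

text \<open>\<open>D X Y\<close> stands for \<open>\<nabla>\<^sub>X Y\<close>. Only the values of \<open>D\<close> on smooth vector fields are relevant.\<close>

definition affine_connection :: "('a, 'n::finite) chart set \<Rightarrow> 'a connection \<Rightarrow> bool" where
  "affine_connection A D \<longleftrightarrow>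
     (\<forall>X Y. smooth_vfield A X \<longrightarrow> smooth_vfield A Y \<longrightarrow> smooth_vfield A (D X Y)) \<and>
     (\<forall>X Y Z. smooth_vfield A X \<longrightarrow> smooth_vfield A Y \<longrightarrow> smooth_vfield A Z \<longrightarrow>
        D (vf_add X Y) Z = vf_add (D X Z) (D Y Z) \<and>
        D Z (vf_add X Y) = vf_add (D Z X) (D Z Y)) \<and>
     (\<forall>h X Y. smooth_fun A h \<longrightarrow> smooth_vfield A X \<longrightarrow> smooth_vfield A Y \<longrightarrow>
        D (vf_scale h X) Y = vf_scale h (D X Y) \<and>
        D X (vf_scale h Y) = vf_add (vf_scale (lie_der X h) Y) (vf_scale h (D X Y)))"

definition levi_civita ::
    "('a, 'n::finite) chart set \<Rightarrow> 'a metric \<Rightarrow> 'a connection \<Rightarrow> bool" where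
  "levi_civita A g D \<longleftrightarrow>
     affine_connection A D \<and>
     (\<forall>X Y. smooth_vfield A X \<longrightarrow> smooth_vfield A Y \<longrightarrow>
        vf_diff (D X Y) (D Y X) = lie_bracket X Y) \<and>
     (\<forall>X Y Z. smooth_vfield A X \<longrightarrow> smooth_vfield A Y \<longrightarrow> smooth_vfield A Z \<longrightarrow>
        lie_der X (metric_app g Y Z) =
          (\<lambda>p. metric_app g (D X Y) Z p + metric_app g Y (D X Z) p))"

definition is_gradient ::
    "('a, 'n::finite) chart set \<Rightarrow> 'a metric \<Rightarrow> ('a \<Rightarrow> real) \<Rightarrow> 'a vfield \<Rightarrow> bool" where
  "is_gradient A g u Z \<longleftrightarrow>
     smooth_vfield A Z \<and> (\<forall>X. smooth_vfield A X \<longrightarrow> metric_app g Z X = lie_der X u)"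

definition grad ::
    "('a, 'n::finite) chart set \<Rightarrow> 'a metric \<Rightarrow> ('a \<Rightarrow> real) \<Rightarrow> 'a vfield" where
  "grad A g u = (THE Z. is_gradient A g u Z)"

definition hess ::
    "('a, 'n::finite) chart set \<Rightarrow> 'a metric \<Rightarrow> 'a connection \<Rightarrow> ('a \<Rightarrow> real) \<Rightarrow>
      'a vfield \<Rightarrow> 'a vfield \<Rightarrow> 'a \<Rightarrow> real" where
  "hess A g D u X Y = metric_app g (D X (grad A g u)) Y"

text \<open>\<open>R(X,Y)Z = \<nabla>\<^sub>X \<nabla>\<^sub>Y Z - \<nabla>\<^sub>Y \<nabla>\<^sub>X Z - \<nabla>\<^bsub>[X,Y]\<^esub> Z\<close>\<close>

definition riemann :: "'a connection \<Rightarrow> 'a vfield \<Rightarrow> 'a vfield \<Rightarrow> 'a vfield \<Rightarrow> 'a vfield" where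
  "riemann D X Y Z = vf_diff (vf_diff (D X (D Y Z)) (D Y (D X Z))) (D (lie_bracket X Y) Z)"

text \<open>Smooth fields, indexed by \<open>'n\<close> and defined on the whole manifold, which are orthonormal at
  the point \<open>p\<close> (not necessarily elsewhere). As the tangent space has dimension \<open>CARD('n)\<close>, their
  values at \<open>p\<close> form an orthonormal basis.\<close>

definition orthonormal_at ::
    "('a, 'n::finite) chart set \<Rightarrow> 'a metric \<Rightarrow> 'a \<Rightarrow> ('n \<Rightarrow> 'a vfield) \<Rightarrow> bool" where
  "orthonormal_at A g p E \<longleftrightarrow>
     (\<forall>i. smooth_vfield A (E i)) \<and>
     (\<forall>i j. metric_app g (E i) (E j) p = (if i = j then 1 else 0))"

text \<open>\<open>Ric(Y,Z)\<close> is the trace of \<open>X \<mapsto> R(X,Y)Z\<close> and \<open>scal\<close> is the \<open>g\<close>-trace of \<open>Ric\<close>. By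
  tensoriality the traces at \<open>p\<close> do not depend on the choice of \<open>E\<close>.\<close>

definition ricci ::
    "('a, 'n::finite) chart set \<Rightarrow> 'a metric \<Rightarrow> 'a connection \<Rightarrow> 'a vfield \<Rightarrow> 'a vfield \<Rightarrow> 'a \<Rightarrow> real"
  where
  "ricci A g D Y Z p = (THE r. \<exists>E. orthonormal_at A g p E \<and>
     r = (\<Sum>i\<in>UNIV. metric_app g (riemann D (E i) Y Z) (E i) p))"

definition scal ::
    "('a, 'n::finite) chart set \<Rightarrow> 'a metric \<Rightarrow> 'a connection \<Rightarrow> 'a \<Rightarrow> real" where
  "scal A g D p = (THE s. \<exists>E. orthonormal_at A g p E \<and>
     s = (\<Sum>i\<in>UNIV. ricci A g D (E i) (E i) p))"


subsection \<open>Solitons\<close>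

text \<open>\<open>Hess(f) + (lam - scal) g + \<mu> df \<otimes> df = 0\<close> with real constants \<open>lam\<close>, \<open>\<mu>\<close>.\<close>

definition gradient_quasi_yamabe_soliton ::
    "('a, 'n::finite) chart set \<Rightarrow> 'a metric \<Rightarrow> 'a connection \<Rightarrow> ('a \<Rightarrow> real) \<Rightarrow> real \<Rightarrow> real \<Rightarrow> bool"
  where
  "gradient_quasi_yamabe_soliton A g D f lam \<mu> \<longleftrightarrow>
     (\<forall>X Y p. smooth_vfield A X \<longrightarrow> smooth_vfield A Y \<longrightarrow>
        hess A g D f X Y p + (lam - scal A g D p) * metric_app g X Y p
          + \<mu> * (lie_der X f p * lie_der Y f p) = 0)"

end

theory Submission
  imports Defs
begin

text \<open>The soliton equation, evaluated on the pair \<open>(\<xi>, \<xi>)\<close>, determines the scalar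
  curvature. As \<open>g(\<xi>, \<xi>) = 1\<close> is constant, metric compatibility of the connection gives
  \<open>0 = \<xi>(g(\<xi>, \<xi>)) = 2 g(\<nabla>\<^sub>\<xi> \<xi>, \<xi>)\<close>, so \<open>Hess(f)(\<xi>, \<xi>) = 0\<close>; and \<open>\<xi>(f) = g(\<xi>, \<xi>) = 1\<close> because
  \<open>\<xi>\<close> is the gradient of \<open>f\<close>. What is left of the equation is \<open>(lam - scal) + \<mu> = 0\<close>, that is,
  \<open>scal = lam + \<mu>\<close> at every point.

  The lemma \<open>hess_unit_gradient\<close> carries the first half of this. The Hessian is
  formed with the field chosen by \<open>grad\<close>, hence it needs to be known that \<open>\<xi>\<close> is the only gradient
  of \<open>f\<close>, which is positive definiteness of \<open>g\<close> (\<open>is_gradient_unique\<close>).\<close>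

lemma tangent_spaceD:
  assumes "v \<in> tangent_space A p"
  shows "\<And>u w. smooth_fun A u \<Longrightarrow> smooth_fun A w \<Longrightarrow> v (\<lambda>x. u x + w x) = v u + v w"
    and "\<And>c u. smooth_fun A u \<Longrightarrow> v (\<lambda>x. c * u x) = c * v u"
    and "\<And>u w. smooth_fun A u \<Longrightarrow> smooth_fun A w \<Longrightarrow>
           v (\<lambda>x. u x * w x) = u p * v w + w p * v u"
    and "\<And>u. \<not> smooth_fun A u \<Longrightarrow> v u = 0"
  using assms unfolding tangent_space_def mem_Collect_eq by simp_all

lemma tangent_diff:
  assumes v: "v \<in> tangent_space A p" and w: "w \<in> tangent_space A p"
  shows "(\<lambda>u. v u - w u) \<in> tangent_space A p"
  unfolding tangent_space_def mem_Collect_eq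
  by (intro conjI allI impI)
    (simp_all add: tangent_spaceD[OF v] tangent_spaceD[OF w] algebra_simps)

lemma tangent_scale:
  assumes v: "v \<in> tangent_space A p"
  shows "(\<lambda>u. c * v u) \<in> tangent_space A p"
  unfolding tangent_space_def mem_Collect_eq
  by (intro conjI allI impI) (simp_all add: tangent_spaceD[OF v] algebra_simps)

text \<open>The Leibniz rule for \<open>1 = 1 * 1\<close> reads \<open>v(1) = 2 v(1)\<close>.\<close>

lemma tangent_one:
  assumes "v \<in> tangent_space A p" "smooth_fun A (\<lambda>x. 1)"
  shows "v (\<lambda>x. 1) = 0"
  using tangent_spaceD(3)[OF assms(1) assms(2) assms(2)] by simp

lemma smooth_vfield_tangent:
  assumes "smooth_vfield A X"
  shows "X p \<in> tangent_space A p"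
  using assms unfolding smooth_vfield_def by blast

lemma riemannian_metricD:
  assumes "riemannian_metric A g" "v \<in> tangent_space A p" "w \<in> tangent_space A p"
  shows metric_sym: "g p v w = g p w v"
    and metric_add_left:
      "z \<in> tangent_space A p \<Longrightarrow> g p (\<lambda>u. v u + w u) z = g p v z + g p w z"
    and metric_scale_left: "g p (\<lambda>u. c * v u) w = c * g p v w"
    and metric_pos: "v \<noteq> (\<lambda>u. 0) \<Longrightarrow> g p v v > 0"
  using assms(1)[unfolded riemannian_metric_def, THEN conjunct1, THEN spec,
      THEN bspec, OF assms(2), THEN bspec, OF assms(3)]
  by simp_all

lemma metric_diff_left:
  assumes g: "riemannian_metric A g"
    and v: "v \<in> tangent_space A p" and w: "w \<in> tangent_space A p" and z: "z \<in> tangent_space A p"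
  shows "g p (\<lambda>u. v u - w u) z = g p v z - g p w z"
  using metric_add_left[OF g v tangent_scale[OF w, of "-1"] z]
    metric_scale_left[OF g w z, of "-1"]
  by simp

text \<open>If \<open>Z\<close> and \<open>W\<close> are gradients of \<open>u\<close>, then \<open>g(Z, Z) = g(W, Z) = Z(u)\<close> and
  \<open>g(Z, W) = g(W, W) = W(u)\<close>, so \<open>Z - W\<close> has length zero at every point. The argument works
  with the tangent vectors \<open>Z p - W p\<close>, which avoids smoothness of the field \<open>Z - W\<close>.\<close>

lemma is_gradient_unique:
  assumes g: "riemannian_metric A g"
    and Z: "is_gradient A g u Z" and W: "is_gradient A g u W"
  shows "Z = W"
proof
  fix p
  have tZ: "Z p \<in> tangent_space A p" and tW: "W p \<in> tangent_space A p"
    using Z W unfolding is_gradient_def by (simp_all add: smooth_vfield_tangent)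
  have eq: "g p (Z p) (X p) = g p (W p) (X p)" if "smooth_vfield A X" for X
  proof -
    have "metric_app g Z X = metric_app g W X"
      using Z W that unfolding is_gradient_def by metis
    then show ?thesis unfolding metric_app_def by (rule fun_cong)
  qed
  let ?d = "\<lambda>u. Z p u - W p u"
  have td: "?d \<in> tangent_space A p" using tZ tW by (rule tangent_diff)
  have "g p ?d (X p) = 0" if X: "smooth_vfield A X" for X
    using metric_diff_left[OF g tZ tW smooth_vfield_tangent[OF X]] eq[OF X] by simp
  then have "g p ?d (Z p) = 0" "g p ?d (W p) = 0"
    using Z W unfolding is_gradient_def by auto
  then have "g p ?d ?d = 0"
    using metric_diff_left[OF g tZ tW td] metric_sym[OF g tZ td] metric_sym[OF g tW td] by simp
  then have "?d = (\<lambda>u. 0)"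
    using metric_pos[OF g td td] by force
  then show "Z p = W p" by (metis eq_iff_diff_eq_0 ext)
qed

lemma grad_eqI:
  assumes "riemannian_metric A g" "is_gradient A g u Z"
  shows "grad A g u = Z"
  unfolding grad_def
proof (rule the_equality)
  show "W = Z" if "is_gradient A g u W" for W
    using is_gradient_unique[OF assms(1) that assms(2)] .
qed (rule assms(2))

text \<open>A field of unit length is orthogonal to its own covariant derivatives, because the
  derivative of the constant function \<open>g(Z, Z) = 1\<close> in the direction of \<open>X\<close> is
  \<open>2 g(\<nabla>\<^sub>X Z, Z)\<close>.\<close>

lemma unit_field_orthogonal_derivative:
  assumes g: "riemannian_metric A g" and D: "levi_civita A g D"
    and X: "smooth_vfield A X" and Z: "smooth_vfield A Z"
    and unit: "metric_app g Z Z = (\<lambda>p. 1)"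
  shows "metric_app g (D X Z) Z p = 0"
proof -
  have DXZ: "smooth_vfield A (D X Z)"
    using D X Z unfolding levi_civita_def affine_connection_def by blast
  \<comment> \<open>The constant \<open>1\<close> is a smooth function because it is \<open>g(Z, Z)\<close>.\<close>
  have "smooth_fun A (metric_app g Z Z)"
    using g Z unfolding riemannian_metric_def by blast
  then have "smooth_fun A (\<lambda>p. 1)" by (simp only: unit)
  then have "lie_der X (metric_app g Z Z) p = 0"
    unfolding unit lie_der_def by (rule tangent_one[OF smooth_vfield_tangent[OF X]])
  moreover have "lie_der X (metric_app g Z Z) =
      (\<lambda>p. metric_app g (D X Z) Z p + metric_app g Z (D X Z) p)"
    using D X Z unfolding levi_civita_def by blast
  moreover have "metric_app g Z (D X Z) p = metric_app g (D X Z) Z p"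
    unfolding metric_app_def
    by (rule metric_sym[OF g smooth_vfield_tangent[OF Z] smooth_vfield_tangent[OF DXZ]])
  ultimately show ?thesis by simp
qed

lemma hess_unit_gradient:
  assumes "riemannian_metric A g" "levi_civita A g D"
    and Z: "is_gradient A g u Z" and "metric_app g Z Z = (\<lambda>p. 1)"
    and "smooth_vfield A X"
  shows "hess A g D u X Z p = 0"
proof -
  have "smooth_vfield A Z" using Z unfolding is_gradient_def by blast
  then show ?thesis
    using assms by (simp add: hess_def grad_eqI unit_field_orthogonal_derivative)
qed

theorem theorem2p3:
  fixes A :: "('a::{t2_space,second_countable_topology}, 'n::finite) chart set"
    and g :: "'a metric"
    and D :: "'a connection"
    and f :: "'a \<Rightarrow> real"
    and \<xi> :: "'a vfield"
    and lam \<mu> :: real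
  assumes "smooth_atlas A"
    and "connected (UNIV :: 'a set)"
    and "CARD('n) > 1"
    and "riemannian_metric A g"
    and "levi_civita A g D"
    and "smooth_fun A f"
    and "is_gradient A g f \<xi>"
    and "\<forall>p. sqrt (metric_app g \<xi> \<xi> p) = 1"
    and "gradient_quasi_yamabe_soliton A g D f lam \<mu>"
    and "\<forall>I \<gamma>. integral_curve A \<xi> I \<gamma> \<longrightarrow> (lie_der \<xi> (scal A g D) \<circ> \<gamma>) constant_on I"
    and "\<forall>p. hess A g D (scal A g D) \<xi> \<xi> p = 0"
  shows "scal A g D constant_on UNIV"
proof -
  have \<xi>: "smooth_vfield A \<xi>"
    using assms(7) unfolding is_gradient_def by blast
  have unit: "metric_app g \<xi> \<xi> = (\<lambda>p. 1)"
    using assms(8) by auto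
  have "lie_der \<xi> f = metric_app g \<xi> \<xi>"
    using assms(7) \<xi> unfolding is_gradient_def by metis
  then have \<xi>f: "lie_der \<xi> f p = 1" for p
    using unit by simp
  have "scal A g D p = lam + \<mu>" for p
  proof -
    have "hess A g D f \<xi> \<xi> p + (lam - scal A g D p) * metric_app g \<xi> \<xi> p
        + \<mu> * (lie_der \<xi> f p * lie_der \<xi> f p) = 0"
      using assms(9) \<xi> unfolding gradient_quasi_yamabe_soliton_def by blast
    then show ?thesis
      using hess_unit_gradient[OF assms(4,5,7) unit \<xi>] by (simp add: unit \<xi>f)
  qed
  then show ?thesis unfolding constant_on_def by blast
qed

end
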